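(* Let $\mathcal{C}$ be a family of convex sets in $\mathbb{R}^d$ that has a Minkowski parametrization in $\mathbb{R}^l$. Let $f : \mathcal{C} \to \mathbb{R}$ be a function such that $f(\lambda A \oplus (1-\lambda) B) \ge \min\{f(A), f(B)\}$ for all $A, B \in \mathcal{C}$ and $\lambda \in [0,1]$. Then, for any finite family $\mathcal{F}$ of convex sets in $\mathbb{R}^d$, if the intersection of every $l+1$ or fewer sets in $\mathcal{F}$ contains a set $K \in \mathcal{C}$ with $f(K) \ge 1$, then $\bigcap \mathcal{F}$ contains a set $K \in \mathcal{C}$ with $f(K) \ge 1$.
   Context: $\oplus$ denotes the Minkowski sum and $\lambda A = \{\lambda a : a \in A\}$. A family $\mathcal{C}$ of convex sets in $\mathbb{R}^d$ has a Minkowski parametrization in $\mathbb{R}^l$ if there is a surjective function $D : \mathbb{R}^l \to \mathcal{C}$ such that $D(\lambda a + (1-\lambda) b) = (\lambda D(a)) \oplus ((1-\lambda) D(b))$ for all $a, b \in \mathbb{R}^l$ and all $\lambda \in [0,1]$. *)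

theory Defs
  imports "HOL-Analysis.Analysis" "HOL-Library.Set_Algebras"
begin

text \<open>Addition of sets is the Minkowski sum, as provided by \<^theory>\<open>HOL-Library.Set_Algebras\<close>.\<close>

definition dilate :: "real \<Rightarrow> (real ^ 'd) set \<Rightarrow> (real ^ 'd) set" where
  "dilate c A = (\<lambda>x. c *\<^sub>R x) ` A"

definition minkowski_parametrization ::
  "(real ^ 'l \<Rightarrow> (real ^ 'd) set) \<Rightarrow> (real ^ 'd) set set \<Rightarrow> bool" where
  "minkowski_parametrization D C \<longleftrightarrow>
     range D = C \<and>
     (\<forall>a b. \<forall>t\<in>{0..1}.
        D (t *\<^sub>R a + (1 - t) *\<^sub>R b) = dilate t (D a) + dilate (1 - t) (D b))"

end

theory Submission
  imports Defs
begin

text \<open>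
  For a convex set \<open>A\<close>, the parameters \<open>a\<close> with \<open>D a \<subseteq> A\<close> and \<open>f (D a) \<ge> 1\<close> form a convex subset
  of the parameter space, because \<open>D\<close> turns convex combinations into Minkowski combinations.
  The result is Helly's theorem applied to these subsets.
\<close>

text \<open>Helly's theorem for an indexed family, where different indices may give the same set and
  the family may be small.\<close>

lemma Helly_finite_image:
  fixes S :: "'b \<Rightarrow> 'a::euclidean_space set"
  assumes "finite F"
    and conv: "\<And>A. A \<in> F \<Longrightarrow> convex (S A)"
    and meet: "\<And>G. G \<subseteq> F \<Longrightarrow> card G \<le> DIM('a) + 1 \<Longrightarrow> (\<Inter>A\<in>G. S A) \<noteq> {}"
  shows "(\<Inter>A\<in>F. S A) \<noteq> {}"
proof -
  have meet': "\<Inter>T \<noteq> {}" if T: "T \<subseteq> S ` F" "card T \<le> DIM('a) + 1" for T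
  proof -
    \<comment> \<open>One index is chosen for each set in \<open>T\<close>, so \<open>G\<close> is
      no larger than \<open>T\<close> and \<open>meet\<close> applies.\<close>
    obtain G where "G \<subseteq> F" "inj_on S G" "T = S ` G"
      using T(1) unfolding subset_image_inj by blast
    then show ?thesis
      using meet[of G] T(2) by (simp add: card_image)
  qed
  show ?thesis
  \<comment> \<open>\<open>Helly\<close> asks for at least \<open>DIM('a) + 1\<close> sets; a
    smaller family is already covered by \<open>meet'\<close>.\<close>
  proof (cases "card (S ` F) \<le> DIM('a) + 1")
    case True
    then show ?thesis using meet'[OF order_refl] by simp
  next
    case False
    show ?thesis
    proof (rule Helly)
      show "DIM('a) + 1 \<le> card (S ` F)" using False by linarith
      show "\<forall>s\<in>S ` F. convex s" using conv by blast
    qed (simp add: meet')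
  qed
qed

lemma dilate_plus_dilate_subset:
  assumes "convex A" "0 \<le> t" "t \<le> 1" "K \<subseteq> A" "L \<subseteq> A"
  shows "dilate t K + dilate (1 - t) L \<subseteq> A"
proof
  fix z assume "z \<in> dilate t K + dilate (1 - t) L"
  then obtain x y where "x \<in> K" "y \<in> L" "z = t *\<^sub>R x + (1 - t) *\<^sub>R y"
    unfolding dilate_def by (auto elim!: set_plus_elim)
  then show "z \<in> A"
    using assms by (auto intro: convexD)
qed

text \<open>Containment in \<open>A\<close> passes to Minkowski combinations because
  \<open>A\<close> is convex; the bound \<open>c\<close> passes because \<open>f\<close> of a
  combination is at least the smaller of the two values.\<close>

lemma convex_parameters:
  fixes D :: "real ^ 'l \<Rightarrow> (real ^ 'd) set"
  assumes D: "minkowski_parametrization D C"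
    and f: "\<forall>A\<in>C. \<forall>B\<in>C. \<forall>t\<in>{0..1}. f (dilate t A + dilate (1 - t) B) \<ge> min (f A) (f B)"
    and A: "convex A"
  shows "convex {a. D a \<subseteq> A \<and> f (D a) \<ge> (c::real)}"
proof (rule convexI)
  fix a b and u v :: real
  assume ab: "a \<in> {a. D a \<subseteq> A \<and> f (D a) \<ge> c}" "b \<in> {a. D a \<subseteq> A \<and> f (D a) \<ge> c}"
    and uv: "0 \<le> u" "0 \<le> v" "u + v = 1"
  have v: "v = 1 - u" and u: "u \<in> {0..1}" using uv by auto
  have comb: "D (u *\<^sub>R a + v *\<^sub>R b) = dilate u (D a) + dilate (1 - u) (D b)"
    using D u unfolding v minkowski_parametrization_def by blast
  have "D a \<in> C" "D b \<in> C"
    using D unfolding minkowski_parametrization_def by auto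
  then have "min (f (D a)) (f (D b)) \<le> f (D (u *\<^sub>R a + v *\<^sub>R b))"
    using f u unfolding comb by blast
  moreover have "D (u *\<^sub>R a + v *\<^sub>R b) \<subseteq> A"
    unfolding comb using A u ab by (intro dilate_plus_dilate_subset) auto
  ultimately show "u *\<^sub>R a + v *\<^sub>R b \<in> {a. D a \<subseteq> A \<and> f (D a) \<ge> c}"
    using ab by auto
qed

theorem theorem2p2:
  fixes C :: "(real ^ 'd) set set"
    and f :: "(real ^ 'd) set \<Rightarrow> real"
    and F :: "(real ^ 'd) set set"
  assumes "\<forall>A\<in>C. convex A"
    and "\<exists>D :: real ^ 'l \<Rightarrow> (real ^ 'd) set. minkowski_parametrization D C"
    and "\<forall>A\<in>C. \<forall>B\<in>C. \<forall>t\<in>{0..1}. f (dilate t A + dilate (1 - t) B) \<ge> min (f A) (f B)"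
    and "finite F"
    and "\<forall>A\<in>F. convex A"
    and "\<forall>G. G \<subseteq> F \<and> card G \<le> CARD('l) + 1 \<longrightarrow> (\<exists>K\<in>C. K \<subseteq> \<Inter>G \<and> f K \<ge> 1)"
  shows "\<exists>K\<in>C. K \<subseteq> \<Inter>F \<and> f K \<ge> 1"
proof (cases "F = {}")
  \<comment> \<open>Over an empty \<open>F\<close> the parameter sets below would not force
    \<open>f (D a) \<ge> 1\<close>; the hypothesis for \<open>G = {}\<close> supplies
    \<open>K\<close> directly.\<close>
  case True
  then show ?thesis using assms(6) by auto
next
  case False
  obtain D :: "real ^ 'l \<Rightarrow> (real ^ 'd) set" where D: "minkowski_parametrization D C"
    using assms(2) by blast
  then have C: "C = range D"
    unfolding minkowski_parametrization_def by auto
  \<comment> \<open>Helly is used in the parameter space \<open>real ^ 'l\<close>, whence the bound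
    \<open>CARD('l) + 1\<close>, independent of \<open>'d\<close>.\<close>
  have "(\<Inter>A\<in>F. {a. D a \<subseteq> A \<and> f (D a) \<ge> 1}) \<noteq> {}"
  proof (rule Helly_finite_image)
    fix G assume "G \<subseteq> F" "card G \<le> DIM(real ^ 'l) + 1"
    then have "\<exists>K\<in>C. K \<subseteq> \<Inter>G \<and> f K \<ge> 1"
      using assms(6) by simp
    \<comment> \<open>Any parameter of \<open>K\<close> is a common point of the sets indexed by
      \<open>G\<close>.\<close>
    then obtain a where "D a \<subseteq> \<Inter>G" "f (D a) \<ge> 1"
      unfolding C by blast
    then show "(\<Inter>A\<in>G. {a. D a \<subseteq> A \<and> f (D a) \<ge> 1}) \<noteq> {}"
      by blast
  qed (simp_all add: assms(4,5) convex_parameters[OF D assms(3)])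
  then obtain a where "\<And>A. A \<in> F \<Longrightarrow> D a \<subseteq> A \<and> f (D a) \<ge> 1"
    by blast
  then show ?thesis
    using False unfolding C by blast
qed

end
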